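(* Let $X=Y^*$ be the dual of a complex normed space $Y$, and let $\ell_j:X\to\mathbb C$ $(j\in J)$ be weak-star continuous linear functionals (equivalently, evaluations against elements of $Y$). Fix coefficients $(a_j)_{j\in J}$ in $\mathbb C$ and $M\ge0$. If for every finite $F\subseteq J$ there is $x_F\in X$ with $$\|x_F\|\le M,\qquad \ell_j(x_F)=a_j\quad(j\in F),$$ then there is one $x\in X$ with $\|x\|\le M$ and $\ell_j(x)=a_j$ for all $j\in J$. *)

theory Defs
  imports "HOL-Analysis.Analysis"
begin

section \<open>Complex normed spaces\<close>

text \<open>The real structure inherited from \<^class>\<open>real_normed_vector\<close> is tied to the complex one by
  \<open>scaleR_scaleC\<close>, so it is just the restriction of scalars.\<close>

class complex_normed_vector = real_normed_vector +
  fixes scaleC :: "complex \<Rightarrow> 'a \<Rightarrow> 'a"  (infixr \<open>*\<^sub>C\<close> 75)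
  assumes scaleC_add_right: "a *\<^sub>C (x + y) = a *\<^sub>C x + a *\<^sub>C y"
    and scaleC_add_left: "(a + b) *\<^sub>C x = a *\<^sub>C x + b *\<^sub>C x"
    and scaleC_scaleC: "a *\<^sub>C b *\<^sub>C x = (a * b) *\<^sub>C x"
    and scaleC_one: "1 *\<^sub>C x = x"
    and scaleR_scaleC: "r *\<^sub>R x = complex_of_real r *\<^sub>C x"
    and norm_scaleC: "norm (a *\<^sub>C x) = cmod a * norm x"

instantiation complex :: complex_normed_vector
begin

definition scaleC_complex :: "complex \<Rightarrow> complex \<Rightarrow> complex"
  where "scaleC_complex = (*)"

instance
  by standard (simp_all add: scaleC_complex_def algebra_simps norm_mult scaleR_conv_of_real)

end

lemma vector_space_scaleC: "vector_space (scaleC :: complex \<Rightarrow> 'a::complex_normed_vector \<Rightarrow> 'a)"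
  by unfold_locales (simp_all add: scaleC_add_right scaleC_add_left scaleC_scaleC scaleC_one)

lemma vector_space_times_complex: "vector_space ((*) :: complex \<Rightarrow> complex \<Rightarrow> complex)"
  by unfold_locales (simp_all add: algebra_simps)

abbreviation clinear_functional :: "('a::complex_normed_vector \<Rightarrow> complex) \<Rightarrow> bool"
  where "clinear_functional \<equiv> Vector_Spaces.linear (*\<^sub>C) (*)"

lemma clinear_functional_iff:
  "clinear_functional f \<longleftrightarrow> (\<forall>x y. f (x + y) = f x + f y) \<and> (\<forall>c x. f (c *\<^sub>C x) = c * f x)"
  by (auto simp: Vector_Spaces.linear_def module_hom_def module_hom_axioms_def
      vector_space_scaleC vector_space_times_complex module_iff_vector_space)

section \<open>The dual space\<close>

typedef (overloaded) 'a cdual =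
  "{f :: 'a::complex_normed_vector \<Rightarrow> complex. clinear_functional f \<and> bounded_linear f}"
  morphisms cdual_apply Cdual
  by (rule exI[of _ "\<lambda>_. 0"]) (simp add: clinear_functional_iff)

setup_lifting type_definition_cdual

text \<open>The norm of the dual is the operator norm \<^const>\<open>onorm\<close>.\<close>

instantiation cdual :: (complex_normed_vector) complex_normed_vector
begin

lift_definition norm_cdual :: "'a cdual \<Rightarrow> real" is onorm .

lift_definition zero_cdual :: "'a cdual" is "\<lambda>_. 0"
  by (simp add: clinear_functional_iff)

lift_definition plus_cdual :: "'a cdual \<Rightarrow> 'a cdual \<Rightarrow> 'a cdual" is "\<lambda>f g y. f y + g y"
  by (auto simp: clinear_functional_iff algebra_simps intro: bounded_linear_add)

lift_definition minus_cdual :: "'a cdual \<Rightarrow> 'a cdual \<Rightarrow> 'a cdual" is "\<lambda>f g y. f y - g y"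
  by (auto simp: clinear_functional_iff algebra_simps intro: bounded_linear_sub)

lift_definition uminus_cdual :: "'a cdual \<Rightarrow> 'a cdual" is "\<lambda>f y. - f y"
  by (auto simp: clinear_functional_iff intro: bounded_linear_minus)

lift_definition scaleR_cdual :: "real \<Rightarrow> 'a cdual \<Rightarrow> 'a cdual" is "\<lambda>r f y. r *\<^sub>R f y"
  by (auto simp: clinear_functional_iff algebra_simps
      intro: bounded_linear_compose[OF bounded_linear_scaleR_right])

lift_definition scaleC_cdual :: "complex \<Rightarrow> 'a cdual \<Rightarrow> 'a cdual" is "\<lambda>c f y. c * f y"
  by (auto simp: clinear_functional_iff algebra_simps
      intro: bounded_linear_compose[OF bounded_linear_mult_right])

definition dist_cdual :: "'a cdual \<Rightarrow> 'a cdual \<Rightarrow> real"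
  where "dist_cdual f g = norm (f - g)"

definition sgn_cdual :: "'a cdual \<Rightarrow> 'a cdual"
  where "sgn_cdual f = inverse (norm f) *\<^sub>R f"

definition uniformity_cdual :: "('a cdual \<times> 'a cdual) filter"
  where "uniformity_cdual = (INF e\<in>{0<..}. principal {(f, g). dist f g < e})"

definition open_cdual :: "'a cdual set \<Rightarrow> bool"
  where "open_cdual S = (\<forall>f\<in>S. \<forall>\<^sub>F (f', g) in uniformity. f' = f \<longrightarrow> g \<in> S)"

lemma onorm_times_complex:
  fixes f :: "'a \<Rightarrow> complex"
  assumes f: "bounded_linear f"
  shows "onorm (\<lambda>y. c * f y) = cmod c * onorm f"
proof (cases "c = 0")
  case True
  then show ?thesis by (simp add: onorm_zero)
next
  case False
  have *: "onorm (\<lambda>y. d * g y) \<le> cmod d * onorm g" if "bounded_linear g" for d and g :: "'a \<Rightarrow> complex"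
    using mult_left_mono[OF onorm[OF that] norm_ge_zero[of d]] onorm_pos_le[OF that]
    by (auto intro!: onorm_bound simp: norm_mult mult.assoc)
  have "bounded_linear (\<lambda>y. c * f y)"
    using f by (rule bounded_linear_compose[OF bounded_linear_mult_right])
  from *[OF this, of "inverse c"] False
  have "cmod c * onorm f \<le> onorm (\<lambda>y. c * f y)"
    by (simp add: mult.assoc[symmetric] norm_inverse) (simp add: field_simps)
  with *[OF f, of c] show ?thesis by simp
qed

instance
proof
  fix f g h :: "'a cdual" and r s :: real and a b :: complex
  show "dist f g = norm (f - g)" by (rule dist_cdual_def)
  show "sgn f = inverse (norm f) *\<^sub>R f" by (rule sgn_cdual_def)
  show "(uniformity :: ('a cdual \<times> 'a cdual) filter) = (INF e\<in>{0<..}. principal {(x, y). dist x y < e})"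
    by (rule uniformity_cdual_def)
  show "open U = (\<forall>x\<in>U. \<forall>\<^sub>F (x', y) in uniformity. x' = x \<longrightarrow> y \<in> U)" for U :: "'a cdual set"
    by (rule open_cdual_def)
  show "f + g + h = f + (g + h)" "f + g = g + f" "0 + f = f" "- f + f = 0" "f - g = f + - g"
    "r *\<^sub>R (f + g) = r *\<^sub>R f + r *\<^sub>R g" "(r + s) *\<^sub>R f = r *\<^sub>R f + s *\<^sub>R f"
    "r *\<^sub>R s *\<^sub>R f = (r * s) *\<^sub>R f" "1 *\<^sub>R f = f"
    "a *\<^sub>C (f + g) = a *\<^sub>C f + a *\<^sub>C g" "(a + b) *\<^sub>C f = a *\<^sub>C f + b *\<^sub>C f"
    "a *\<^sub>C b *\<^sub>C f = (a * b) *\<^sub>C f" "1 *\<^sub>C f = f" "r *\<^sub>R f = complex_of_real r *\<^sub>C f"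
    by (transfer, simp add: algebra_simps scaleR_conv_of_real)+
  show "norm f = 0 \<longleftrightarrow> f = 0"
    by transfer (auto simp: onorm_eq_0)
  show "norm (f + g) \<le> norm f + norm g"
    by transfer (simp add: onorm_triangle)
  show "norm (r *\<^sub>R f) = \<bar>r\<bar> * norm f"
    by transfer (simp add: onorm_scaleR)
  show "norm (a *\<^sub>C f) = cmod a * norm f"
    by transfer (simp add: onorm_times_complex)
qed

end

section \<open>The weak-star topology\<close>

text \<open>The coarsest topology making all evaluations continuous, i.e. the one pulled back from the
  product topology (pointwise convergence) along \<^const>\<open>cdual_apply\<close>.\<close>

definition weak_star :: "'a::complex_normed_vector cdual topology"
  where "weak_star = pullback_topology UNIV cdual_apply (product_topology (\<lambda>_. euclidean) UNIV)"

lemma topspace_weak_star [simp]: "topspace weak_star = UNIV"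
  by (simp add: weak_star_def topspace_pullback_topology)

lemma continuous_map_weak_star_evaluation:
  "continuous_map weak_star euclidean (\<lambda>f. cdual_apply f y)"
  using continuous_map_pullback[OF continuous_map_product_projection[of y UNIV "\<lambda>_. euclidean"],
      of UNIV cdual_apply]
  by (simp add: weak_star_def o_def)

lemma continuous_map_into_weak_star:
  assumes "\<And>y. continuous_map T euclidean (\<lambda>t. cdual_apply (g t) y)"
  shows "continuous_map T weak_star g"
  unfolding weak_star_def
  by (rule continuous_map_pullback') (use assms in \<open>auto simp: continuous_map_componentwise_UNIV o_def\<close>)

lemma clinear_functional_evaluation: "clinear_functional (\<lambda>f. cdual_apply f y)"
  by (simp add: clinear_functional_iff plus_cdual.rep_eq scaleC_cdual.rep_eq)

end

theory Submission
  imports Defs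
begin

text \<open>
  The theorem is Banach--Alaoglu combined with the finite intersection property. The solutions of
  one equation \<open>l j x = a j\<close> form a weak-star closed set, since \<open>l j\<close> is weak-star continuous; the
  hypothesis on finite \<open>F \<subseteq> J\<close> says that finitely many of these sets always meet the ball of
  radius \<open>M\<close>. That ball is weak-star compact (\<open>compactin_weak_star_ball\<close>), so all of the sets
  meet it in a common point.

  For the compactness, a functional is a point of the product of copies of the complex plane
  indexed by the vectors, and lies in the ball iff it is linear and its coordinate at \<open>y\<close> lies in
  the disc of radius \<open>M * norm y\<close>. The product of the discs is compact by Tychonoff, and linearity
  is a system of equations in finitely many coordinates each, so it cuts out a closed subset.
\<close>

lemma closed_clinear_functionals:
  "closed {f :: 'a::complex_normed_vector \<Rightarrow> complex. clinear_functional f}"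
  unfolding clinear_functional_iff
  by (intro closed_Collect_conj closed_Collect_all closed_Collect_eq continuous_intros
      continuous_on_product_coordinates)

lemma norm_cdual_apply_le: "cmod (cdual_apply f y) \<le> norm f * norm y"
  by transfer (use onorm in blast)

lemma norm_cdual_le:
  assumes "0 \<le> M" and "\<And>y. cmod (cdual_apply f y) \<le> M * norm y"
  shows "norm f \<le> M"
  using assms by transfer (rule onorm_bound)

text \<open>Boundedness follows from the bounds on the single values, so membership in the dual is
  decided by conditions on finitely many coordinates at a time, which survive pointwise limits.\<close>

lemma cdual_apply_Cdual:
  assumes lin: "clinear_functional f" and bound: "\<And>y. cmod (f y) \<le> M * norm y"
  shows "cdual_apply (Cdual f) = f"
proof (rule Cdual_inverse)
  have "f (r *\<^sub>R y) = r *\<^sub>R f y" for r y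
  proof -
    have "f (complex_of_real r *\<^sub>C y) = complex_of_real r * f y"
      using lin unfolding clinear_functional_iff by blast
    then show ?thesis
      by (simp only: scaleR_scaleC[of r y] scaleR_conv_of_real)
  qed
  then have "bounded_linear f"
    using lin bound
    by (intro bounded_linear_intro[where K = M])
      (auto simp: clinear_functional_iff mult.commute)
  with lin show "f \<in> {f. clinear_functional f \<and> bounded_linear f}"
    by simp
qed

text \<open>Banach--Alaoglu. The ball is the image of a compact set of functions under \<^const>\<open>Cdual\<close>,
  which is continuous there because both topologies are those of pointwise convergence.\<close>

theorem compactin_weak_star_ball:
  assumes "0 \<le> M"
  shows "compactin weak_star {x :: 'a::complex_normed_vector cdual. norm x \<le> M}"
proof -
  define K :: "('a \<Rightarrow> complex) set"
    where "K = (\<Pi>\<^sub>E y\<in>UNIV. cball 0 (M * norm y)) \<inter> {f. clinear_functional f}"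
  have "compactin (product_topology (\<lambda>_. euclidean) UNIV)
      (\<Pi>\<^sub>E y\<in>(UNIV :: 'a set). cball (0 :: complex) (M * norm y))"
    by (simp add: compactin_PiE)
  then have "compact K"
    unfolding K_def
    by (intro compact_Int_closed closed_clinear_functionals)
      (simp add: euclidean_product_topology flip: compactin_euclidean_iff)
  then have compact_K: "compactin (top_of_set K) K"
    by (simp add: compactin_subtopology)
  have apply_Cdual: "cdual_apply (Cdual f) = f" if "f \<in> K" for f
    using that by (intro cdual_apply_Cdual[where M = M]) (auto simp: K_def PiE_iff)
  have "continuous_map (top_of_set K) weak_star Cdual"
  proof (rule continuous_map_into_weak_star)
    fix y :: 'a
    have "continuous_on K (\<lambda>f. f y)"
      by (rule continuous_on_subset[OF continuous_on_product_coordinates]) simp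
    then have "continuous_map (top_of_set K) euclidean (\<lambda>f. f y)"
      by simp
    then show "continuous_map (top_of_set K) euclidean (\<lambda>f. cdual_apply (Cdual f) y)"
      by (rule continuous_map_eq) (simp add: apply_Cdual)
  qed
  with compact_K have "compactin weak_star (Cdual ` K)"
    by (rule image_compactin)
  moreover have "Cdual ` K = {x. norm x \<le> M}"
  proof (intro equalityI subsetI)
    fix x assume "x \<in> Cdual ` K"
    then obtain f where "f \<in> K" "x = Cdual f"
      by blast
    then show "x \<in> {x. norm x \<le> M}"
      using \<open>0 \<le> M\<close> by (auto intro!: norm_cdual_le simp: apply_Cdual) (auto simp: K_def PiE_iff)
  next
    fix x :: "'a cdual" assume "x \<in> {x. norm x \<le> M}"
    then have "norm x * norm y \<le> M * norm y" for y :: 'a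
      by (simp add: mult_right_mono)
    then have "cmod (cdual_apply x y) \<le> M * norm y" for y
      using norm_cdual_apply_le[of x y] by (rule order_trans[rotated])
    moreover have "clinear_functional (cdual_apply x)"
      using cdual_apply[of x] by simp
    ultimately have "cdual_apply x \<in> K"
      by (auto simp: K_def PiE_iff)
    then show "x \<in> Cdual ` K"
      by (metis cdual_apply_inverse imageI)
  qed
  ultimately show ?thesis
    by simp
qed

theorem proposition30p5:
  fixes J :: "'j set"
    and l :: "'j \<Rightarrow> 'y::complex_normed_vector cdual \<Rightarrow> complex"
    and a :: "'j \<Rightarrow> complex"
    and M :: real
  assumes "\<And>j. j \<in> J \<Longrightarrow> clinear_functional (l j)"
    and "\<And>j. j \<in> J \<Longrightarrow> continuous_map weak_star euclidean (l j)"
    and "M \<ge> 0"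
    and "\<And>F. finite F \<Longrightarrow> F \<subseteq> J \<Longrightarrow> \<exists>x. norm x \<le> M \<and> (\<forall>j\<in>F. l j x = a j)"
  shows "\<exists>x. norm x \<le> M \<and> (\<forall>j\<in>J. l j x = a j)"
proof -
  let ?B = "{x :: 'y cdual. norm x \<le> M}"
  define S where "S j = {x. l j x = a j}" for j
  have "closedin weak_star (S j)" if "j \<in> J" for j
    using closedin_continuous_map_preimage[OF assms(2)[OF that], of "{a j}"]
    by (simp add: S_def)
  then have closed: "\<forall>C\<in>S ` J. closedin weak_star C"
    by blast
  have fip: "?B \<inter> \<Inter>\<F> \<noteq> {}" if "finite \<F>" "\<F> \<subseteq> S ` J" for \<F>
  proof -
    from that obtain F where "F \<subseteq> J" "finite F" "\<F> = S ` F"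
      by (meson finite_subset_image)
    with assms(4)[of F] show ?thesis
      by (auto simp: S_def)
  qed
  have "?B \<inter> \<Inter>(S ` J) \<noteq> {}"
    using compactin_weak_star_ball[OF \<open>M \<ge> 0\<close>] closed fip
    unfolding compactin_fip by blast
  then show ?thesis
    by (auto simp: S_def)
qed

end
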